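(* Let $R$ be a quasiorder on a set $U$. Then the rough set algebra $\mathbb{RS}$ determined by $R$ is a three-valued {\L}ukasiewicz algebra if and only if $R$ is an equivalence relation.
   Context: Quasiorder: a reflexive and transitive binary relation. Rough sets: for a binary relation $R$ on $U$, put $R(x)=\{y\in U\mid x\,R\,y\}$, and for $X\subseteq U$ put $X^{\blacktriangledown}=\{x\in U\mid R(x)\subseteq X\}$, $X^{\blacktriangle}=\{x\in U\mid R(x)\cap X\ne\emptyset\}$, $\mathcal{A}(X)=(X^{\blacktriangledown},X^{\blacktriangle})$. Let $RS=\{\mathcal{A}(X)\mid X\subseteq U\}$, ordered by coordinatewise inclusion. When $R$ is a quasiorder, it is known that $RS$ is a complete sublattice of $\wp(U)\times\wp(U)$ (so joins and meets are coordinatewise unions and intersections), and that $\mathbb{RS}=(RS,\vee,\wedge,c,(\emptyset,\emptyset),(U,U))$ with $c(\mathcal{A}(X))=\mathcal{A}(U\setminus X)$ is a (well-defined) De Morgan algebra, i.e. a bounded distributive lattice with an order-reversing involution $c$. A three-valued {\L}ukasiewicz algebra is an algebra $(A,\vee,\wedge,c,\Delta,1)$ such that $A$ is a distributive lattice (with greatest element $1$), $c$ and $\Delta$ are unary operations, and for all $x,y\in A$: (1) $c(c(x))=x$; (2) $c(x\wedge y)=c(x)\vee c(y)$; (3) $c(x)\vee\Delta(x)=1$; (4) $x\wedge c(x)=c(x)\wedge\Delta(x)$; (5) $\Delta(x\wedge y)=\Delta(x)\wedge\Delta(y)$. Saying that $\mathbb{RS}$ is a three-valued {\L}ukasiewicz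 algebra means that there exists a unary operation $\Delta$ on $RS$ such that $(RS,\vee,\wedge,c,\Delta,(U,U))$ satisfies these conditions. *)

theory Defs
  imports "HOL-Algebra.Lattice"
begin

text \<open>
  Lattices are those of HOL-Algebra: joins and meets are suprema and infima with respect to the
  order \<open>\<sqsubseteq>\<close> of the structure, relative to its carrier.  The record below adds to an ordered set
  the remaining operations of a De Morgan algebra.
\<close>

record 'a neg_order = "'a gorder" +
  neg :: "'a \<Rightarrow> 'a"
  bot_elem :: 'a
  top_elem :: 'a

locale three_valued_lukasiewicz_algebra = lattice L
  for L :: "('a, 'b) neg_order_scheme" (structure) and \<Delta> :: "'a \<Rightarrow> 'a" +
  assumes distrib:
      "\<lbrakk>x \<in> carrier L; y \<in> carrier L; z \<in> carrier L\<rbrakk>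
        \<Longrightarrow> x \<sqinter> (y \<squnion> z) = (x \<sqinter> y) \<squnion> (x \<sqinter> z)"
    and top_elem_greatest: "greatest L (top_elem L) (carrier L)"
    and neg_closed: "x \<in> carrier L \<Longrightarrow> neg L x \<in> carrier L"
    and Delta_closed: "x \<in> carrier L \<Longrightarrow> \<Delta> x \<in> carrier L"
    and neg_neg: "x \<in> carrier L \<Longrightarrow> neg L (neg L x) = x"
    and neg_meet: "\<lbrakk>x \<in> carrier L; y \<in> carrier L\<rbrakk> \<Longrightarrow> neg L (x \<sqinter> y) = neg L x \<squnion> neg L y"
    and neg_join_Delta: "x \<in> carrier L \<Longrightarrow> neg L x \<squnion> \<Delta> x = top_elem L"
    and meet_neg: "x \<in> carrier L \<Longrightarrow> x \<sqinter> neg L x = neg L x \<sqinter> \<Delta> x"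
    and Delta_meet: "\<lbrakk>x \<in> carrier L; y \<in> carrier L\<rbrakk> \<Longrightarrow> \<Delta> (x \<sqinter> y) = \<Delta> x \<sqinter> \<Delta> y"

definition lower_approx :: "'a set \<Rightarrow> 'a rel \<Rightarrow> 'a set \<Rightarrow> 'a set" where
  "lower_approx U R X = {x \<in> U. R `` {x} \<subseteq> X}"

definition upper_approx :: "'a set \<Rightarrow> 'a rel \<Rightarrow> 'a set \<Rightarrow> 'a set" where
  "upper_approx U R X = {x \<in> U. R `` {x} \<inter> X \<noteq> {}}"

definition rough_set :: "'a set \<Rightarrow> 'a rel \<Rightarrow> 'a set \<Rightarrow> 'a set \<times> 'a set" where
  "rough_set U R X = (lower_approx U R X, upper_approx U R X)"

definition rough_neg :: "'a set \<Rightarrow> 'a rel \<Rightarrow> 'a set \<times> 'a set \<Rightarrow> 'a set \<times> 'a set" where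
  "rough_neg U R p = (THE q. \<exists>X \<subseteq> U. p = rough_set U R X \<and> q = rough_set U R (U - X))"

text \<open>
  The description in \<^const>\<open>rough_neg\<close> is well-defined: the approximations of \<open>U - X\<close>
  depend only on those of \<open>X\<close>.
\<close>

lemma rough_set_Compl:
  assumes "R \<subseteq> U \<times> U"
  shows "rough_set U R (U - X) = (U - upper_approx U R X, U - lower_approx U R X)"
  using assms by (auto simp: rough_set_def lower_approx_def upper_approx_def)

lemma rough_neg_rough_set:
  assumes "R \<subseteq> U \<times> U" and "X \<subseteq> U"
  shows "rough_neg U R (rough_set U R X) = rough_set U R (U - X)"
  unfolding rough_neg_def
proof (rule the_equality)
  show "\<exists>Y \<subseteq> U. rough_set U R X = rough_set U R Y \<and>
      rough_set U R (U - X) = rough_set U R (U - Y)"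
    using assms(2) by blast
next
  fix q
  assume "\<exists>Y \<subseteq> U. rough_set U R X = rough_set U R Y \<and> q = rough_set U R (U - Y)"
  then show "q = rough_set U R (U - X)"
    unfolding rough_set_Compl[OF assms(1)] by (auto simp: rough_set_def)
qed

definition rough_set_algebra :: "'a set \<Rightarrow> 'a rel \<Rightarrow> ('a set \<times> 'a set) neg_order" where
  "rough_set_algebra U R =
    \<lparr>carrier = rough_set U R ` Pow U,
     eq = (=),
     le = (\<lambda>p q. fst p \<subseteq> fst q \<and> snd p \<subseteq> snd q),
     neg = rough_neg U R,
     bot_elem = ({}, {}),
     top_elem = (U, U)\<rparr>"

end

theory Submission
  imports Defs
begin

text \<open>
  Write \<open>X\<^sup>l\<close> and \<open>X\<^sup>u\<close> for the lower and upper approximation of \<open>X\<close>.  The heart of the matter is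
  that the axioms leave only one possible value for \<open>\<Delta>\<close>, namely \<open>\<Delta> (X\<^sup>l, X\<^sup>u) = (X\<^sup>u, X\<^sup>u)\<close>, so the
  question is when these pairs are rough sets.

  If \<open>(X\<^sup>u, X\<^sup>u)\<close> is the rough set of \<open>Z\<close>, then \<open>Z\<^sup>l \<subseteq> Z \<subseteq> Z\<^sup>u\<close> by reflexivity, so \<open>Z = X\<^sup>u\<close>, and
  \<open>Z\<^sup>l = Z\<close> says that \<open>X\<^sup>u\<close> contains all \<open>R\<close>-successors of its points.  For \<open>X = {x}\<close> the set \<open>X\<^sup>u\<close>
  consists of the \<open>R\<close>-predecessors of \<open>x\<close>; being reflexive, \<open>R\<close> is then symmetric.

  That \<open>\<Delta>\<close> has this value would be immediate from coordinatewise joins and meets, but the fact that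
  joins and meets of rough sets of an arbitrary quasiorder are coordinatewise is a nontrivial theorem.
  It is avoided by testing rough sets only against those of singletons: \<open>rough_set_singleton_le\<close>
  says that the rough set of \<open>{w}\<close> lies below that of \<open>X\<close> exactly if \<open>w \<in> X\<^sup>u\<close>.  This controls meets,
  and by complementation the rough sets of the sets \<open>U - {w}\<close> control joins.

  Conversely, for an equivalence \<open>R\<close> the sets \<open>X\<^sup>u\<close> are unions of classes and so \<open>(X\<^sup>u, X\<^sup>u)\<close> is
  the rough set of \<open>X\<^sup>u\<close>.  Here the rough sets are closed under coordinatewise unions and
  intersections by a direct class-by-class argument (\<open>rough_sets_Un_closed\<close>), and all the axioms become
  identities between sets.
\<close>

section \<open>Approximations\<close>

lemma carrier_rough_set_algebra [simp]:
  "carrier (rough_set_algebra U R) = rough_set U R ` Pow U"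
  by (simp add: rough_set_algebra_def)

lemma le_rough_set_algebra [simp]:
  "p \<sqsubseteq>\<^bsub>rough_set_algebra U R\<^esub> q \<longleftrightarrow> fst p \<subseteq> fst q \<and> snd p \<subseteq> snd q"
  by (simp add: rough_set_algebra_def)

lemma eq_rough_set_algebra [simp]: "eq (rough_set_algebra U R) = (=)"
  by (simp add: rough_set_algebra_def)

lemma neg_rough_set_algebra [simp]: "neg (rough_set_algebra U R) = rough_neg U R"
  by (simp add: rough_set_algebra_def)

lemma top_rough_set_algebra [simp]: "top_elem (rough_set_algebra U R) = (U, U)"
  by (simp add: rough_set_algebra_def)

lemma fst_rough_set [simp]: "fst (rough_set U R X) = lower_approx U R X"
  and snd_rough_set [simp]: "snd (rough_set U R X) = upper_approx U R X"
  by (simp_all add: rough_set_def)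

lemma lower_approx_subset:
  assumes "refl_on U R"
  shows "lower_approx U R X \<subseteq> X"
  using assms by (auto simp: lower_approx_def dest: refl_onD)

lemma subset_upper_approx:
  assumes "refl_on U R" "X \<subseteq> U"
  shows "X \<subseteq> upper_approx U R X"
  using assms by (auto simp: upper_approx_def dest: refl_onD)

lemma lower_subset_upper_approx:
  assumes "refl_on U R"
  shows "lower_approx U R X \<subseteq> upper_approx U R X"
  using assms by (auto simp: lower_approx_def upper_approx_def dest: refl_onD)

lemma rough_neg_rough_set_pair:
  assumes "R \<subseteq> U \<times> U" "X \<subseteq> U"
  shows "rough_neg U R (rough_set U R X) = (U - upper_approx U R X, U - lower_approx U R X)"
  using assms by (simp add: rough_neg_rough_set rough_set_Compl)

section \<open>The value of the modal operator for a quasiorder\<close>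

text \<open>
  By transitivity the upper approximation of \<open>X\<close> contains the predecessors of its points.  The lower
  approximation of \<open>{w}\<close> contains at most \<open>w\<close>, and it contains \<open>w\<close> only if \<open>w\<close> is its own sole
  successor; every set whose upper approximation contains such a \<open>w\<close> has it in its lower
  approximation as well.
\<close>
lemma rough_set_singleton_le:
  assumes "preorder_on U R" "w \<in> U"
  shows "rough_set U R {w} \<sqsubseteq>\<^bsub>rough_set_algebra U R\<^esub> rough_set U R X \<longleftrightarrow> w \<in> upper_approx U R X"
proof
  assume "rough_set U R {w} \<sqsubseteq>\<^bsub>rough_set_algebra U R\<^esub> rough_set U R X"
  moreover have "w \<in> upper_approx U R {w}"
    using assms subset_upper_approx[of U R "{w}"] by (auto simp: preorder_on_def)
  ultimately show "w \<in> upper_approx U R X"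
    by auto
next
  assume w: "w \<in> upper_approx U R X"
  have refl: "refl_on U R" and trans: "trans R"
    using assms(1) by (auto simp: preorder_on_def)
  have "lower_approx U R {w} \<subseteq> lower_approx U R X"
  proof
    fix z assume z: "z \<in> lower_approx U R {w}"
    then have "z = w"
      using lower_approx_subset[OF refl] by blast
    with z w show "z \<in> lower_approx U R X"
      by (auto simp: lower_approx_def upper_approx_def)
  qed
  moreover have "upper_approx U R {w} \<subseteq> upper_approx U R X"
    using w trans by (auto simp: upper_approx_def dest: transD)
  ultimately show "rough_set U R {w} \<sqsubseteq>\<^bsub>rough_set_algebra U R\<^esub> rough_set U R X"
    by simp
qed

lemma rough_set_Compl_antimono:
  assumes "R \<subseteq> U \<times> U"
    and "rough_set U R X \<sqsubseteq>\<^bsub>rough_set_algebra U R\<^esub> rough_set U R Y"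
  shows "rough_set U R (U - Y) \<sqsubseteq>\<^bsub>rough_set_algebra U R\<^esub> rough_set U R (U - X)"
  using assms(2) by (auto simp: rough_set_Compl[OF assms(1)])

text \<open>
  Let the value of \<open>\<Delta>\<close> at the rough set of \<open>X\<close> be the rough set of \<open>Z\<close>.
  If \<open>w\<close> were in the upper approximation of \<open>X\<close> but not in the lower one of \<open>Z\<close>, then the rough set of
  \<open>U - {w}\<close> would be an upper bound, different from the top element, of the rough sets of \<open>U - X\<close> and
  \<open>Z\<close>.  If \<open>w\<close> were in the upper approximation of \<open>Z\<close> but not in that of \<open>X\<close>, then the rough set of
  \<open>{w}\<close> would be below those of \<open>U - X\<close> and \<open>Z\<close> but not below that of \<open>X\<close>, although the meet of
  the first two is also the meet of the rough sets of \<open>X\<close> and \<open>U - X\<close>.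
\<close>
lemma Delta_rough_set:
  assumes pre: "preorder_on U R"
    and luk: "three_valued_lukasiewicz_algebra (rough_set_algebra U R) \<Delta>"
    and X: "X \<subseteq> U"
  shows "\<Delta> (rough_set U R X) = (upper_approx U R X, upper_approx U R X)"
proof -
  interpret three_valued_lukasiewicz_algebra "rough_set_algebra U R" \<Delta>
    by (fact luk)
  have sub: "R \<subseteq> U \<times> U" and refl: "refl_on U R"
    using pre by (auto simp: preorder_on_def)
  let ?L = "rough_set_algebra U R" and ?A = "rough_set U R"
  have AX: "?A X \<in> carrier ?L" and AcX: "?A (U - X) \<in> carrier ?L"
    using X by auto
  have "\<Delta> (?A X) \<in> carrier ?L"
    using AX by (rule Delta_closed)
  then obtain Z where Z: "Z \<subseteq> U" and DZ: "\<Delta> (?A X) = ?A Z"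
    by auto
  have AZ: "?A Z \<in> carrier ?L"
    using Z by auto
  have join: "?A (U - X) \<squnion>\<^bsub>?L\<^esub> ?A Z = (U, U)"
    using neg_join_Delta[OF AX] by (simp add: rough_neg_rough_set[OF sub X] DZ)
  have meet: "?A X \<sqinter>\<^bsub>?L\<^esub> ?A (U - X) = ?A (U - X) \<sqinter>\<^bsub>?L\<^esub> ?A Z"
    using meet_neg[OF AX] by (simp add: rough_neg_rough_set[OF sub X] DZ)
  have "upper_approx U R X \<subseteq> lower_approx U R Z"
  proof (rule ccontr)
    assume "\<not> upper_approx U R X \<subseteq> lower_approx U R Z"
    then obtain w where w: "w \<in> upper_approx U R X" "w \<notin> lower_approx U R Z"
      by blast
    then have wU: "w \<in> U"
      by (simp add: upper_approx_def)
    have "w \<in> upper_approx U R (U - Z)"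
      using w(2) wU rough_set_Compl[OF sub, of Z] by (simp add: rough_set_def)
    then have "?A {w} \<sqsubseteq>\<^bsub>?L\<^esub> ?A X" "?A {w} \<sqsubseteq>\<^bsub>?L\<^esub> ?A (U - Z)"
      using w(1) rough_set_singleton_le[OF pre wU] by blast+
    then have "?A (U - X) \<sqsubseteq>\<^bsub>?L\<^esub> ?A (U - {w})" "?A (U - (U - Z)) \<sqsubseteq>\<^bsub>?L\<^esub> ?A (U - {w})"
      by (blast intro: rough_set_Compl_antimono[OF sub])+
    then have "?A (U - X) \<squnion>\<^bsub>?L\<^esub> ?A Z \<sqsubseteq>\<^bsub>?L\<^esub> ?A (U - {w})"
      using AcX AZ Z by (intro join_le) (auto simp: double_diff)
    then have "U \<subseteq> lower_approx U R (U - {w})"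
      by (simp add: join)
    then show False
      using wU lower_approx_subset[OF refl, of "U - {w}"] by blast
  qed
  moreover have "upper_approx U R Z \<subseteq> upper_approx U R X"
  proof (rule ccontr)
    assume "\<not> upper_approx U R Z \<subseteq> upper_approx U R X"
    then obtain w where w: "w \<in> upper_approx U R Z" "w \<notin> upper_approx U R X"
      by blast
    then have wU: "w \<in> U"
      by (simp add: upper_approx_def)
    have "w \<notin> lower_approx U R X"
      using w(2) lower_subset_upper_approx[OF refl] by blast
    then have "w \<in> upper_approx U R (U - X)"
      using wU rough_set_Compl[OF sub, of X] by (simp add: rough_set_def)
    then have "?A {w} \<sqsubseteq>\<^bsub>?L\<^esub> ?A (U - X)" "?A {w} \<sqsubseteq>\<^bsub>?L\<^esub> ?A Z"
      using w(1) rough_set_singleton_le[OF pre wU] by blast+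
    then have "?A {w} \<sqsubseteq>\<^bsub>?L\<^esub> ?A (U - X) \<sqinter>\<^bsub>?L\<^esub> ?A Z"
      using AcX AZ wU by (intro meet_le) auto
    then have "?A {w} \<sqsubseteq>\<^bsub>?L\<^esub> ?A X"
      using meet_left[OF AX AcX] unfolding meet by auto
    then show False
      using w(2) rough_set_singleton_le[OF pre wU] by blast
  qed
  ultimately have "lower_approx U R Z = upper_approx U R X" "upper_approx U R Z = upper_approx U R X"
    using lower_subset_upper_approx[OF refl, of Z] by blast+
  then show ?thesis
    unfolding DZ by (simp add: rough_set_def)
qed

lemma lukasiewicz_imp_sym:
  assumes pre: "preorder_on U R"
    and luk: "three_valued_lukasiewicz_algebra (rough_set_algebra U R) \<Delta>"
  shows "sym R"
proof (rule symI)
  fix x y assume xy: "(x, y) \<in> R"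
  interpret three_valued_lukasiewicz_algebra "rough_set_algebra U R" \<Delta>
    by (fact luk)
  have sub: "R \<subseteq> U \<times> U" and refl: "refl_on U R"
    using pre by (auto simp: preorder_on_def)
  let ?B = "upper_approx U R {x}"
  have x: "{x} \<subseteq> U"
    using xy sub by auto
  have "\<Delta> (rough_set U R {x}) \<in> carrier (rough_set_algebra U R)"
    using x by (intro Delta_closed) auto
  then obtain Z where Z: "Z \<subseteq> U" "rough_set U R Z = (?B, ?B)"
    using Delta_rough_set[OF pre luk x] by auto
  then have "?B = Z" "lower_approx U R Z = Z"
    using lower_approx_subset[OF refl, of Z] subset_upper_approx[OF refl Z(1)]
    by (auto simp: rough_set_def)
  moreover have "x \<in> ?B"
    using subset_upper_approx[OF refl x] by simp
  ultimately have "y \<in> ?B"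
    using xy by (auto simp: lower_approx_def)
  then show "(y, x) \<in> R"
    by (simp add: upper_approx_def)
qed

section \<open>The rough set algebra of an equivalence\<close>

text \<open>
  The union \<open>X \<union> Y\<close> has the right upper approximation, but it may fill a class that neither \<open>X\<close>
  nor \<open>Y\<close> fills.  Hence \<open>Y\<close> is discarded on the classes that \<open>X\<close> meets, except those that \<open>Y\<close> fills.
\<close>
lemma rough_sets_Un_closed:
  assumes eq: "equiv U R" and X: "X \<subseteq> U" and Y: "Y \<subseteq> U"
  shows "(lower_approx U R X \<union> lower_approx U R Y, upper_approx U R X \<union> upper_approx U R Y)
    \<in> rough_set U R ` Pow U"
proof -
  define Z where "Z = X \<union> (Y - upper_approx U R X) \<union> lower_approx U R Y"
  have mem: "z \<in> Z \<longleftrightarrow> z \<in> X \<or> z \<in> Y \<and> R `` {x} \<inter> X = {} \<or> R `` {x} \<subseteq> Y"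
    if "z \<in> R `` {x}" for x z
  proof -
    have "R `` {x} = R `` {z}"
      using that by (intro equiv_class_eq[OF eq]) simp
    moreover have "z \<in> U"
      using that eq by (auto elim: equivE)
    ultimately show ?thesis
      by (simp add: Z_def lower_approx_def upper_approx_def)
  qed
  have "R `` {x} \<subseteq> Z \<longleftrightarrow> R `` {x} \<subseteq> X \<or> R `` {x} \<subseteq> Y"
    "R `` {x} \<inter> Z \<noteq> {} \<longleftrightarrow> R `` {x} \<inter> X \<noteq> {} \<or> R `` {x} \<inter> Y \<noteq> {}" if "x \<in> U" for x
  proof -
    have "x \<in> R `` {x}"
      using eq that by (rule equiv_class_self)
    then show "R `` {x} \<subseteq> Z \<longleftrightarrow> R `` {x} \<subseteq> X \<or> R `` {x} \<subseteq> Y"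
      "R `` {x} \<inter> Z \<noteq> {} \<longleftrightarrow> R `` {x} \<inter> X \<noteq> {} \<or> R `` {x} \<inter> Y \<noteq> {}"
      unfolding subset_eq[of "R `` {x}" Z] disjoint_iff[of "R `` {x}" Z]
      using mem[of _ x] by (smt (verit) subset_eq disjoint_iff)+
  qed
  then have "lower_approx U R Z = lower_approx U R X \<union> lower_approx U R Y"
    "upper_approx U R Z = upper_approx U R X \<union> upper_approx U R Y"
    unfolding lower_approx_def upper_approx_def by blast+
  moreover have "Z \<subseteq> U"
    using X Y by (auto simp: Z_def lower_approx_def)
  ultimately show ?thesis
    by (intro image_eqI[of _ _ Z]) (simp_all add: rough_set_def)
qed

lemma rough_sets_Int_closed:
  assumes eq: "equiv U R" and X: "X \<subseteq> U" and Y: "Y \<subseteq> U"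
  shows "(lower_approx U R X \<inter> lower_approx U R Y, upper_approx U R X \<inter> upper_approx U R Y)
    \<in> rough_set U R ` Pow U"
proof -
  have sub: "R \<subseteq> U \<times> U"
    using eq by (auto elim: equivE)
  have "rough_set U R (U - (U - X)) = rough_set U R X" "rough_set U R (U - (U - Y)) = rough_set U R Y"
    using X Y by (simp_all add: double_diff)
  note dbl = this
  obtain Z where Z: "Z \<subseteq> U" "rough_set U R Z =
      (lower_approx U R (U - X) \<union> lower_approx U R (U - Y),
       upper_approx U R (U - X) \<union> upper_approx U R (U - Y))"
    using rough_sets_Un_closed[OF eq, of "U - X" "U - Y"] by auto
  have "rough_set U R (U - Z) =
      (lower_approx U R X \<inter> lower_approx U R Y, upper_approx U R X \<inter> upper_approx U R Y)"
    using Z(2) dbl unfolding rough_set_Compl[OF sub] by (auto simp: rough_set_def)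
  then show ?thesis
    by (intro image_eqI[of _ _ "U - Z"]) auto
qed

text \<open>The upper approximation of \<open>X\<close> is a union of classes, hence equal to both its approximations.\<close>
lemma rough_set_upper_approx:
  assumes "equiv U R"
  shows "rough_set U R (upper_approx U R X) = (upper_approx U R X, upper_approx U R X)"
proof -
  let ?B = "upper_approx U R X"
  have refl: "refl_on U R"
    using assms by (auto elim: equivE)
  have saturated: "z \<in> ?B \<longleftrightarrow> x \<in> ?B" if "(x, z) \<in> R" for x z
  proof -
    have "x \<in> U" "z \<in> U"
      using that assms by (auto elim: equivE)
    then show ?thesis
      by (simp add: upper_approx_def equiv_class_eq[OF assms that])
  qed
  have "R `` {x} \<subseteq> ?B \<longleftrightarrow> x \<in> ?B" "R `` {x} \<inter> ?B \<noteq> {} \<longleftrightarrow> x \<in> ?B" if "x \<in> U" for x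
    using saturated refl_onD[OF refl that] by blast+
  moreover have "?B \<subseteq> U"
    by (auto simp: upper_approx_def)
  ultimately have "lower_approx U R ?B = ?B" "upper_approx U R ?B = ?B"
    unfolding lower_approx_def[of U R ?B] upper_approx_def[of U R ?B] by blast+
  then show ?thesis
    by (simp add: rough_set_def)
qed

lemma equiv_least_Upper:
  assumes "equiv U R" "p \<in> rough_set U R ` Pow U" "q \<in> rough_set U R ` Pow U"
  shows "least (rough_set_algebra U R) (fst p \<union> fst q, snd p \<union> snd q)
    (Upper (rough_set_algebra U R) {p, q})"
proof (rule least_UpperI)
  show pq: "{p, q} \<subseteq> carrier (rough_set_algebra U R)"
    using assms(2,3) by simp
  show "(fst p \<union> fst q, snd p \<union> snd q) \<in> carrier (rough_set_algebra U R)"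
    using assms by (auto intro!: rough_sets_Un_closed)
  fix r assume "r \<in> Upper (rough_set_algebra U R) {p, q}"
  then have "p \<sqsubseteq>\<^bsub>rough_set_algebra U R\<^esub> r" "q \<sqsubseteq>\<^bsub>rough_set_algebra U R\<^esub> r"
    using pq by (blast dest: Upper_memD)+
  then show "(fst p \<union> fst q, snd p \<union> snd q) \<sqsubseteq>\<^bsub>rough_set_algebra U R\<^esub> r"
    by simp
qed auto

lemma equiv_greatest_Lower:
  assumes "equiv U R" "p \<in> rough_set U R ` Pow U" "q \<in> rough_set U R ` Pow U"
  shows "greatest (rough_set_algebra U R) (fst p \<inter> fst q, snd p \<inter> snd q)
    (Lower (rough_set_algebra U R) {p, q})"
proof (rule greatest_LowerI)
  show pq: "{p, q} \<subseteq> carrier (rough_set_algebra U R)"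
    using assms(2,3) by simp
  show "(fst p \<inter> fst q, snd p \<inter> snd q) \<in> carrier (rough_set_algebra U R)"
    using assms by (auto intro!: rough_sets_Int_closed)
  fix r assume "r \<in> Lower (rough_set_algebra U R) {p, q}"
  then have "r \<sqsubseteq>\<^bsub>rough_set_algebra U R\<^esub> p" "r \<sqsubseteq>\<^bsub>rough_set_algebra U R\<^esub> q"
    using pq by (blast dest: Lower_memD)+
  then show "r \<sqsubseteq>\<^bsub>rough_set_algebra U R\<^esub> (fst p \<inter> fst q, snd p \<inter> snd q)"
    by simp
qed auto

lemma equiv_lattice:
  assumes "equiv U R"
  shows "lattice (rough_set_algebra U R)"
proof unfold_locales
  fix p q
  assume "p \<in> carrier (rough_set_algebra U R)" "q \<in> carrier (rough_set_algebra U R)"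
  then have pq: "p \<in> rough_set U R ` Pow U" "q \<in> rough_set U R ` Pow U"
    by simp_all
  show "\<exists>s. least (rough_set_algebra U R) s (Upper (rough_set_algebra U R) {p, q})"
    using equiv_least_Upper[OF assms pq] by (rule exI)
  show "\<exists>s. greatest (rough_set_algebra U R) s (Lower (rough_set_algebra U R) {p, q})"
    using equiv_greatest_Lower[OF assms pq] by (rule exI)
qed (simp_all add: prod_eq_iff del: carrier_rough_set_algebra, blast+)

lemma equiv_join:
  assumes "equiv U R" "p \<in> rough_set U R ` Pow U" "q \<in> rough_set U R ` Pow U"
  shows "p \<squnion>\<^bsub>rough_set_algebra U R\<^esub> q = (fst p \<union> fst q, snd p \<union> snd q)"
proof -
  interpret lattice "rough_set_algebra U R"
    by (rule equiv_lattice[OF assms(1)])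
  show ?thesis
    unfolding join_def
    by (rule least_unique[OF sup_of_two_least equiv_least_Upper[OF assms]]) (use assms(2,3) in simp_all)
qed

lemma equiv_meet:
  assumes "equiv U R" "p \<in> rough_set U R ` Pow U" "q \<in> rough_set U R ` Pow U"
  shows "p \<sqinter>\<^bsub>rough_set_algebra U R\<^esub> q = (fst p \<inter> fst q, snd p \<inter> snd q)"
proof -
  interpret lattice "rough_set_algebra U R"
    by (rule equiv_lattice[OF assms(1)])
  show ?thesis
    unfolding meet_def
    by (rule greatest_unique[OF inf_of_two_greatest equiv_greatest_Lower[OF assms]]) (use assms(2,3) in simp_all)
qed

lemma equiv_imp_lukasiewicz:
  assumes eq: "equiv U R"
  shows "three_valued_lukasiewicz_algebra (rough_set_algebra U R) (\<lambda>p. (snd p, snd p))"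
proof -
  let ?L = "rough_set_algebra U R" and ?RS = "rough_set U R ` Pow U"
  interpret lattice ?L
    by (rule equiv_lattice[OF eq])
  have sub: "R \<subseteq> U \<times> U" and refl: "refl_on U R"
    using eq by (auto elim: equivE)
  note join = equiv_join[OF eq] and meet = equiv_meet[OF eq]
  have join_RS: "(fst p \<union> fst q, snd p \<union> snd q) \<in> ?RS" if "p \<in> ?RS" "q \<in> ?RS" for p q
    using join_closed[of p q] that by (simp add: join)
  have meet_RS: "(fst p \<inter> fst q, snd p \<inter> snd q) \<in> ?RS" if "p \<in> ?RS" "q \<in> ?RS" for p q
    using meet_closed[of p q] that by (simp add: meet)
  have neg: "rough_neg U R p = (U - snd p, U - fst p)" if "p \<in> ?RS" for p
    using that by (auto simp: rough_neg_rough_set_pair[OF sub])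
  have neg_RS: "(U - snd p, U - fst p) \<in> ?RS" if "p \<in> ?RS" for p
    using that by (auto simp flip: rough_set_Compl[OF sub])
  have Delta_RS: "(snd p, snd p) \<in> ?RS" if p: "p \<in> ?RS" for p
  proof -
    obtain X where "p = rough_set U R X"
      using p by auto
    then have "(snd p, snd p) = rough_set U R (snd p)"
      by (simp add: rough_set_upper_approx[OF eq])
    moreover have "snd p \<subseteq> U"
      using p by (auto simp: upper_approx_def)
    ultimately show ?thesis
      by blast
  qed
  have lower_le_upper: "fst p \<subseteq> snd p" if "p \<in> ?RS" for p
    using that by (auto intro: subsetD[OF lower_subset_upper_approx[OF refl]])
  have upper_le: "snd p \<subseteq> U" if "p \<in> ?RS" for p
    using that by (auto simp: upper_approx_def)
  have top_RS: "(U, U) \<in> ?RS"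
  proof -
    have "rough_set U R U = (U, U)"
      using sub refl by (auto simp: rough_set_def lower_approx_def upper_approx_def dest: refl_onD)
    then show ?thesis
      by (intro image_eqI[of _ _ U]) auto
  qed
  show ?thesis
  proof unfold_locales
    show "greatest ?L (top_elem ?L) (carrier ?L)"
      unfolding greatest_def
    proof (intro conjI ballI)
      show "top_elem ?L \<in> carrier ?L"
        using top_RS by simp
      fix p assume "p \<in> carrier ?L"
      then have "p \<in> ?RS" by simp
      then show "p \<sqsubseteq>\<^bsub>?L\<^esub> top_elem ?L"
        using lower_le_upper[of p] upper_le[of p] by simp
    qed simp
  next
    fix p assume "p \<in> carrier ?L"
    then have p: "p \<in> ?RS" by simp
    note b = lower_le_upper[OF p] upper_le[OF p]
    show "neg ?L p \<in> carrier ?L" "(snd p, snd p) \<in> carrier ?L"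
      using neg_RS[OF p] Delta_RS[OF p] p by (simp_all add: neg)
    show "neg ?L (neg ?L p) = p"
      using b by (simp add: neg p neg_RS double_diff prod_eq_iff)
    show "neg ?L p \<squnion>\<^bsub>?L\<^esub> (snd p, snd p) = top_elem ?L"
      using b by (auto simp: neg join p neg_RS Delta_RS)
    show "p \<sqinter>\<^bsub>?L\<^esub> neg ?L p = neg ?L p \<sqinter>\<^bsub>?L\<^esub> (snd p, snd p)"
      using b by (auto simp: neg meet p neg_RS Delta_RS)
    fix q assume "q \<in> carrier ?L"
    then have q: "q \<in> ?RS" by simp
    show "neg ?L (p \<sqinter>\<^bsub>?L\<^esub> q) = neg ?L p \<squnion>\<^bsub>?L\<^esub> neg ?L q"
      by (auto simp: neg meet join p q neg_RS meet_RS)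
    show "(snd (p \<sqinter>\<^bsub>?L\<^esub> q), snd (p \<sqinter>\<^bsub>?L\<^esub> q)) = (snd p, snd p) \<sqinter>\<^bsub>?L\<^esub> (snd q, snd q)"
      by (simp add: meet p q Delta_RS)
    fix r assume "r \<in> carrier ?L"
    then have r: "r \<in> ?RS" by simp
    show "p \<sqinter>\<^bsub>?L\<^esub> (q \<squnion>\<^bsub>?L\<^esub> r) = (p \<sqinter>\<^bsub>?L\<^esub> q) \<squnion>\<^bsub>?L\<^esub> (p \<sqinter>\<^bsub>?L\<^esub> r)"
      by (auto simp: meet join p q r join_RS meet_RS)
  qed
qed

theorem proposition4p5:
  fixes U :: "'a set" and R :: "'a rel"
  assumes "preorder_on U R"
  shows "(\<exists>\<Delta>. three_valued_lukasiewicz_algebra (rough_set_algebra U R) \<Delta>) \<longleftrightarrow> equiv U R"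
proof
  assume "\<exists>\<Delta>. three_valued_lukasiewicz_algebra (rough_set_algebra U R) \<Delta>"
  then have "sym R"
    using lukasiewicz_imp_sym[OF assms] by blast
  with assms show "equiv U R"
    by (simp add: equiv_def preorder_on_def)
next
  assume "equiv U R"
  then show "\<exists>\<Delta>. three_valued_lukasiewicz_algebra (rough_set_algebra U R) \<Delta>"
    by (blast intro: equiv_imp_lukasiewicz)
qed

end
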